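(* Let $d\ge 1$, let $\sigma_{\min}\in(0,1)$ be fixed, and let $\boldsymbol{x}_1\in\mathbb{R}^d$ be a fixed data point. For $t_m\in[0,\infty)$ and $\sigma_m\in(0,\infty)$, let $\boldsymbol{x}_m\sim\mathcal{N}(t_m\boldsymbol{x}_1,\sigma_m^2\boldsymbol{I})$ and $\boldsymbol{x}_0\sim\mathcal{N}(\boldsymbol{0},\boldsymbol{I})$ be independent random vectors in $\mathbb{R}^d$. Put $$\Delta=(1-\sigma_{\min})t_m+\sigma_m,\qquad \tau=\min\left(t_m,\frac{t_m}{\Delta}\right),$$ and define $$\boldsymbol{x}_\tau=\begin{cases}\sqrt{(1-(1-\sigma_{\min})t_m)^2-\sigma_m^2}\,\boldsymbol{x}_0+\boldsymbol{x}_m, & \text{if }\Delta<1,\\[4pt] \dfrac{1}{\Delta}\boldsymbol{x}_m, & \text{if }\Delta\ge 1.\end{cases}$$ Then: (i) $\boldsymbol{x}_\tau$ lies on the conditional OT (CondOT) paths with corresponding time $\tau$, i.e. $\boldsymbol{x}_\tau\sim\mathcal{N}\big(\tau\boldsymbol{x}_1,(1-(1-\sigma_{\min})\tau)^2\boldsymbol{I}\big)$. (ii) The distribution of $\boldsymbol{x}_\tau$ varies continuously with respect to $t_m$ and $\sigma_m$ under the Wasserstein-2 metric: the map sending $(t_m,\sigma_m)\in[0,\infty)\times(0,\infty)$ to the law of $\boldsymbol{x}_\tau$ is continuous into the space of probability measures on $\mathbb{R}^d$ with finite second moment, equipped with the Wasserstein-2 distance.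
   Context: Conditional OT (CondOT) paths: given a data sample $\boldsymbol{x}_1\in\mathbb{R}^d$ and a fixed small constant $\sigma_{\min}$, the conditional probability path is $p_t(\cdot\mid\boldsymbol{x}_1)=\mathcal{N}(\boldsymbol{\mu}_t(\boldsymbol{x}_1),\sigma_t(\boldsymbol{x}_1)^2\boldsymbol{I})$ with mean $\boldsymbol{\mu}_t(\boldsymbol{x}_1)=t\boldsymbol{x}_1$ and standard deviation $\sigma_t(\boldsymbol{x}_1)=1-(1-\sigma_{\min})t$. A random vector is said to lie on the CondOT paths with corresponding time $\tau$ if it is Gaussian with mean $\tau\boldsymbol{x}_1$ and covariance $(1-(1-\sigma_{\min})\tau)^2\boldsymbol{I}$. Here $\boldsymbol{I}$ is the $d\times d$ identity matrix. The Wasserstein-2 distance is taken with respect to the Euclidean norm on $\mathbb{R}^d$. *)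

theory Defs
  imports "HOL-Probability.Probability"
begin

text \<open>
  The density formula is the Gaussian law for positive definite \<open>S\<close> only; degenerate covariances
  are not covered.
\<close>

definition mvn_density :: "real^'n \<Rightarrow> real^'n^'n \<Rightarrow> real^'n \<Rightarrow> real" where
  "mvn_density \<mu> S x =
     exp (- ((x - \<mu>) \<bullet> (matrix_inv S *v (x - \<mu>))) / 2) / sqrt ((2 * pi) ^ CARD('n) * det S)"

definition mvn :: "real^'n \<Rightarrow> real^'n^'n \<Rightarrow> (real^'n) measure" where
  "mvn \<mu> S = density lborel (\<lambda>x. ennreal (mvn_density \<mu> S x))"

definition condot_law :: "real \<Rightarrow> real^'n \<Rightarrow> real \<Rightarrow> (real^'n) measure" where
  "condot_law \<sigma>min x1 t = mvn (t *\<^sub>R x1) ((1 - (1 - \<sigma>min) * t)\<^sup>2 *\<^sub>R mat 1)"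

definition on_condot_path ::
  "'w measure \<Rightarrow> ('w \<Rightarrow> real^'n) \<Rightarrow> real \<Rightarrow> real^'n \<Rightarrow> real \<Rightarrow> bool" where
  "on_condot_path M X \<sigma>min x1 \<tau> \<longleftrightarrow>
     X \<in> borel_measurable M \<and> distr M borel X = condot_law \<sigma>min x1 \<tau>"

definition Delta :: "real \<Rightarrow> real \<Rightarrow> real \<Rightarrow> real" where
  "Delta \<sigma>min tm \<sigma>m = (1 - \<sigma>min) * tm + \<sigma>m"

definition tau :: "real \<Rightarrow> real \<Rightarrow> real \<Rightarrow> real" where
  "tau \<sigma>min tm \<sigma>m = min tm (tm / Delta \<sigma>min tm \<sigma>m)"

definition x_tau ::
  "real \<Rightarrow> real \<Rightarrow> real \<Rightarrow> ('w \<Rightarrow> real^'n) \<Rightarrow> ('w \<Rightarrow> real^'n) \<Rightarrow> 'w \<Rightarrow> real^'n" where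
  "x_tau \<sigma>min tm \<sigma>m X0 Xm w =
     (if Delta \<sigma>min tm \<sigma>m < 1
      then sqrt ((1 - (1 - \<sigma>min) * tm)\<^sup>2 - \<sigma>m\<^sup>2) *\<^sub>R X0 w + Xm w
      else (1 / Delta \<sigma>min tm \<sigma>m) *\<^sub>R Xm w)"

text \<open>Measurability of \<open>X0\<close> and \<open>Xm\<close> is part of \<^const>\<open>prob_space.indep_var\<close>.\<close>

definition source_pair ::
  "'w measure \<Rightarrow> ('w \<Rightarrow> real^'n) \<Rightarrow> ('w \<Rightarrow> real^'n) \<Rightarrow> real^'n \<Rightarrow> real \<Rightarrow> real \<Rightarrow> bool" where
  "source_pair M X0 Xm x1 tm \<sigma>m \<longleftrightarrow>
     prob_space M \<and>
     prob_space.indep_var M borel X0 borel Xm \<and>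
     distr M borel X0 = mvn 0 (mat 1) \<and>
     distr M borel Xm = mvn (tm *\<^sub>R x1) (\<sigma>m\<^sup>2 *\<^sub>R mat 1)"

definition P2 :: "'a::euclidean_space measure set" where
  "P2 = {\<mu>. prob_space \<mu> \<and> sets \<mu> = sets borel \<and> integrable \<mu> (\<lambda>x. (norm x)\<^sup>2)}"

definition couplings :: "'a measure \<Rightarrow> 'b measure \<Rightarrow> ('a \<times> 'b) measure set" where
  "couplings \<mu> \<nu> =
     {\<gamma>. sets \<gamma> = sets (\<mu> \<Otimes>\<^sub>M \<nu>) \<and> distr \<gamma> \<mu> fst = \<mu> \<and> distr \<gamma> \<nu> snd = \<nu>}"

text \<open>
  The infimum is finite for \<open>\<mu>, \<nu> \<in> P2\<close>; outside \<^const>\<open>P2\<close> it may be infinite, and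
  \<^const>\<open>enn2real\<close> then yields \<open>0\<close>.
\<close>

definition wasserstein2 :: "'a::euclidean_space measure \<Rightarrow> 'a measure \<Rightarrow> real" where
  "wasserstein2 \<mu> \<nu> =
     sqrt (enn2real (INF \<gamma>\<in>couplings \<mu> \<nu>. \<integral>\<^sup>+ p. ennreal ((dist (fst p) (snd p))\<^sup>2) \<partial>\<gamma>))"

text \<open>
  The last conjunct is continuity at every point of \<open>D\<close>; together with membership in
  \<^const>\<open>P2\<close> it says that \<open>L\<close> is a continuous map from \<open>D\<close> to \<^const>\<open>P2\<close> metrized by
  \<^const>\<open>wasserstein2\<close>.
\<close>

definition wasserstein2_continuous_on ::
  "'p::topological_space set \<Rightarrow> ('p \<Rightarrow> 'a::euclidean_space measure) \<Rightarrow> bool" where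
  "wasserstein2_continuous_on D L \<longleftrightarrow>
     (\<forall>p\<in>D. L p \<in> P2) \<and>
     (\<forall>p\<in>D. ((\<lambda>q. wasserstein2 (L q) (L p)) \<longlongrightarrow> 0) (at p within D))"

end

theory Submission
  imports Defs
begin

text \<open>
  For \<open>\<Delta> < 1\<close> independence adds the variances of \<open>x\<^sub>0\<close> and \<open>x\<^sub>m\<close> up to
  \<open>(1 - (1 - \<sigma>\<^sub>m\<^sub>i\<^sub>n) t\<^sub>m)\<^sup>2\<close>; for \<open>\<Delta> \<ge> 1\<close> the rescaled standard deviation is
  \<open>\<sigma>\<^sub>m / \<Delta> = 1 - (1 - \<sigma>\<^sub>m\<^sub>i\<^sub>n) \<tau>\<close>. Hence the law of \<open>x\<^sub>\<tau>\<close> depends on the parameters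
  only through \<open>\<tau>\<close>, which is continuous. Two laws \<open>N(a, r\<^sup>2 I)\<close> and \<open>N(b, s\<^sup>2 I)\<close> are
  coupled as \<open>a + r Z\<close> and \<open>b + s Z\<close> with the same standard Gaussian \<open>Z\<close>, so that their squared
  distance is at most \<open>2 \<parallel>a - b\<parallel>\<^sup>2 + 2 (r - s)\<^sup>2 E \<parallel>Z\<parallel>\<^sup>2\<close>.
\<close>

section \<open>Densities of isotropic Gaussians\<close>

lemma matrix_inv_eqI:
  fixes A :: "'a::semiring_1^'n^'m"
  assumes "A ** B = mat 1" "B ** A = mat 1"
  shows "matrix_inv A = B"
  unfolding matrix_inv_def
proof (rule some_equality)
  fix C assume "A ** C = mat 1 \<and> C ** A = mat 1"
  then show "C = B"
    using assms(1) by (metis matrix_mul_assoc matrix_mul_lid matrix_mul_rid)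
qed (use assms in simp)

lemma matrix_inv_scaleR_mat:
  assumes "c \<noteq> (0::real)"
  shows "matrix_inv (c *\<^sub>R mat 1 :: real^'n^'n) = (1 / c) *\<^sub>R mat 1"
  by (rule matrix_inv_eqI)
     (use assms in \<open>simp_all add: scalar_matrix_assoc[symmetric] matrix_scalar_ac\<close>)

lemma det_scaleR_mat: "det (c *\<^sub>R mat 1 :: real^'n^'n) = c ^ CARD('n)"
  by (subst det_diagonal) (auto simp: mat_def)

lemma mvn_density_isotropic:
  fixes \<mu> x :: "real^'n"
  assumes "0 < s"
  shows "mvn_density \<mu> (s\<^sup>2 *\<^sub>R mat 1) x =
    exp (- (norm (x - \<mu>))\<^sup>2 / (2 * s\<^sup>2)) / sqrt (2 * pi * s\<^sup>2) ^ CARD('n)"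
proof -
  have "(2 * pi) ^ CARD('n) * (s\<^sup>2) ^ CARD('n) = (2 * pi * s\<^sup>2) ^ CARD('n)"
    by (simp add: power_mult_distrib)
  moreover have "matrix_inv (s\<^sup>2 *\<^sub>R mat 1 :: real^'n^'n) *v (x - \<mu>) = (1 / s\<^sup>2) *\<^sub>R (x - \<mu>)"
    using assms by (simp add: matrix_inv_scaleR_mat scaleR_matrix_vector_assoc[symmetric])
  ultimately show ?thesis
    unfolding mvn_density_def det_scaleR_mat
    using assms by (simp add: real_sqrt_power[symmetric] power2_norm_eq_inner mult.commute)
qed

text \<open>The squared norm is a sum over coordinates, so the exponential splits, and each
  coordinate takes one normalising factor. Total mass and convolution thus reduce to facts on the
  real line.\<close>

lemma mvn_density_isotropic_prod:
  fixes \<mu> x :: "real^'n"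
  assumes "0 < s"
  shows "mvn_density \<mu> (s\<^sup>2 *\<^sub>R mat 1) x = (\<Prod>b\<in>Basis. normal_density (\<mu> \<bullet> b) s (x \<bullet> b))"
proof -
  have n: "(norm (x - \<mu>))\<^sup>2 = (\<Sum>b\<in>Basis. (x \<bullet> b - \<mu> \<bullet> b)\<^sup>2)"
    unfolding power2_norm_eq_inner
    by (subst euclidean_inner) (simp add: inner_diff_left power2_eq_square)
  have "exp (- (norm (x - \<mu>))\<^sup>2 / (2 * s\<^sup>2)) = (\<Prod>b\<in>Basis. exp (- (x \<bullet> b - \<mu> \<bullet> b)\<^sup>2 / (2 * s\<^sup>2)))"
    unfolding n by (simp add: exp_sum sum_divide_distrib flip: sum_negf)
  then show ?thesis
    unfolding mvn_density_isotropic[OF assms] normal_density_def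
    by (simp add: prod.distrib prod_dividef)
qed

lemma borel_measurable_mvn_density_isotropic:
  assumes "0 < s"
  shows "mvn_density (\<mu> :: real^'n) (s\<^sup>2 *\<^sub>R mat 1) \<in> borel_measurable borel"
  unfolding mvn_density_isotropic[OF assms, abs_def] by measurable

lemma mvn_density_isotropic_nonneg:
  "0 < s \<Longrightarrow> 0 \<le> mvn_density (\<mu> :: real^'n) (s\<^sup>2 *\<^sub>R mat 1) x"
  by (simp add: mvn_density_isotropic)

lemma sets_mvn [simp, measurable_cong]: "sets (mvn \<mu> S) = sets borel"
  by (simp add: mvn_def)

lemma space_mvn [simp]: "space (mvn \<mu> S) = UNIV"
  by (simp add: mvn_def)

lemma prob_space_mvn_isotropic:
  assumes "0 < s"
  shows "prob_space (mvn (\<mu> :: real^'n) (s\<^sup>2 *\<^sub>R mat 1))"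
proof
  have one: "(\<integral>\<^sup>+x. ennreal (normal_density m s x) \<partial>lborel) = 1" for m
    using prob_space.emeasure_space_1[OF prob_space_normal_density[OF assms, of m]]
    by (simp add: emeasure_density)
  note [measurable] = borel_measurable_mvn_density_isotropic[OF assms]
  have "emeasure (mvn \<mu> (s\<^sup>2 *\<^sub>R mat 1)) UNIV =
      (\<integral>\<^sup>+x. (\<Prod>b\<in>Basis. ennreal (normal_density (\<mu> \<bullet> b) s (x \<bullet> b))) \<partial>lborel)"
    by (simp add: mvn_def emeasure_density mvn_density_isotropic_prod[OF assms] prod_ennreal)
  also have "\<dots> = 1"
    by (subst nn_integral_lborel_prod) (simp_all add: one)
  finally show "emeasure (mvn \<mu> (s\<^sup>2 *\<^sub>R mat 1)) (space (mvn \<mu> (s\<^sup>2 *\<^sub>R mat 1))) = 1"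
    by simp
qed

section \<open>Affine images and independent sums\<close>

lemma distr_affine_density_lborel:
  fixes f :: "'a::euclidean_space \<Rightarrow> ennreal"
  assumes [measurable]: "f \<in> borel_measurable borel" and c: "c \<noteq> 0"
  shows "distr (density lborel f) borel (\<lambda>x. a + c *\<^sub>R x) =
    density lborel (\<lambda>y. f ((y - a) /\<^sub>R c) / ennreal (\<bar>c\<bar> ^ DIM('a)))" (is "?L = ?R")
proof (rule measure_eqI)
  show "sets ?L = sets ?R" by simp
  fix A assume "A \<in> sets ?L"
  then have [measurable]: "A \<in> sets borel" by simp
  have [measurable]: "(\<lambda>x. a + c *\<^sub>R x) \<in> density lborel f \<rightarrow>\<^sub>M borel" by simp
  \<comment> \<open>Cancellation in \<open>ennreal\<close> needs a factor that is finite and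
    nonzero; \<open>c\<close> supplies this.\<close>
  have cc: "ennreal (\<bar>c\<bar> ^ DIM('a)) * (u / ennreal (\<bar>c\<bar> ^ DIM('a)) * v) = u * v" for u v
  proof -
    have "ennreal (\<bar>c\<bar> ^ DIM('a)) * (u / ennreal (\<bar>c\<bar> ^ DIM('a))) = u"
      using c by (simp add: ennreal_times_divide mult.commute ennreal_mult_divide_eq)
    then show ?thesis by (metis mult.assoc)
  qed
  have "emeasure ?R A = (\<integral>\<^sup>+y. f ((y - a) /\<^sub>R c) / ennreal (\<bar>c\<bar> ^ DIM('a)) * indicator A y \<partial>lborel)"
    by (subst emeasure_density) auto
  also have "\<dots> = (\<integral>\<^sup>+x. f x * indicator A (a + c *\<^sub>R x) \<partial>lborel)"
    \<comment> \<open>Lebesgue measure is rewritten as its own image under the affine map, weighted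
      by \<bar>c\<bar> to the dimension; this weight cancels the divisor.\<close>
    using c by (subst lborel_affine[OF c, of a])
      (simp add: nn_integral_density nn_integral_distr cc ennreal_power)
  also have "\<dots> = (\<integral>\<^sup>+x. f x * indicator ((\<lambda>x. a + c *\<^sub>R x) -` A) x \<partial>lborel)"
    by (simp add: indicator_def)
  also have "\<dots> = emeasure (density lborel f) ((\<lambda>x. a + c *\<^sub>R x) -` A)"
    by (subst emeasure_density) (auto simp: measurable_sets_borel[OF _ \<open>A \<in> sets borel\<close>])
  also have "\<dots> = emeasure ?L A"
    by (subst emeasure_distr) auto
  finally show "emeasure ?L A = emeasure ?R A" by simp
qed

text \<open>The Jacobian factor is absorbed by the normalising constant, which turns
  \<open>s\<close> into \<open>c * s\<close>, while the exponent rescales because the norm is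
  homogeneous.\<close>

lemma distr_affine_mvn_isotropic:
  fixes \<mu> a :: "real^'n"
  assumes "0 < s" "0 < c"
  shows "distr (mvn \<mu> (s\<^sup>2 *\<^sub>R mat 1)) borel (\<lambda>x. a + c *\<^sub>R x) =
    mvn (a + c *\<^sub>R \<mu>) ((c * s)\<^sup>2 *\<^sub>R mat 1)"
proof -
  have "mvn_density \<mu> (s\<^sup>2 *\<^sub>R mat 1) ((y - a) /\<^sub>R c) / c ^ DIM(real^'n) =
      mvn_density (a + c *\<^sub>R \<mu>) ((c * s)\<^sup>2 *\<^sub>R mat 1) y" for y
  proof -
    have "(y - a) /\<^sub>R c - \<mu> = (y - (a + c *\<^sub>R \<mu>)) /\<^sub>R c"
      using assms by (simp add: algebra_simps)
    then have n: "norm ((y - a) /\<^sub>R c - \<mu>) = norm (y - (a + c *\<^sub>R \<mu>)) / c"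
      using assms by (simp add: divide_inverse_commute)
    show ?thesis
      unfolding mvn_density_isotropic[OF assms(1)] mvn_density_isotropic[OF mult_pos_pos[OF assms(2,1)]] n
      using assms by (simp add: real_sqrt_mult power_mult_distrib power_divide mult.commute mult.left_commute)
  qed
  then show ?thesis
    unfolding mvn_def using assms
    by (subst distr_affine_density_lborel)
       (auto simp: borel_measurable_mvn_density_isotropic divide_ennreal mvn_density_isotropic_nonneg)
qed

text \<open>Translation invariance of Lebesgue measure moves the shift by y into the first density,
  and Tonelli then exchanges the two integrals. Finiteness of both measures provides the
  sigma-finite pair.\<close>

lemma distr_add_pair_density_lborel:
  fixes f g :: "'a::euclidean_space \<Rightarrow> ennreal"
  assumes [measurable]: "f \<in> borel_measurable borel" "g \<in> borel_measurable borel"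
    and "finite_measure (density lborel f)" "finite_measure (density lborel g)"
  shows "distr (density lborel f \<Otimes>\<^sub>M density lborel g) borel (\<lambda>(x, y). x + y) =
    density lborel (\<lambda>x. \<integral>\<^sup>+y. f (x - y) * g y \<partial>lborel)" (is "?L = ?R")
proof (rule measure_eqI)
  show "sets ?L = sets ?R" by simp
  fix A assume "A \<in> sets ?L"
  then have [measurable]: "A \<in> sets borel" by simp
  interpret F: finite_measure "density lborel f" by fact
  interpret G: finite_measure "density lborel g" by fact
  interpret pair_sigma_finite "density lborel f" "density lborel g" ..
  have shift: "(\<integral>\<^sup>+x. f x * indicator A (x + y) \<partial>lborel) =
      (\<integral>\<^sup>+x. f (x - y) * indicator A x \<partial>lborel)" for y
    by (subst (2) lborel_distr_plus[of y, symmetric]) (simp add: nn_integral_distr add.commute)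
  have "emeasure ?L A = (\<integral>\<^sup>+p. indicator A (fst p + snd p) \<partial>(density lborel f \<Otimes>\<^sub>M density lborel g))"
    by (subst nn_integral_indicator[symmetric], simp, subst nn_integral_distr)
       (auto simp: case_prod_beta)
  also have "\<dots> = (\<integral>\<^sup>+y. \<integral>\<^sup>+x. indicator A (x + y) \<partial>density lborel f \<partial>density lborel g)"
    by (subst nn_integral_snd[symmetric]) auto
  also have "\<dots> = (\<integral>\<^sup>+y. g y * (\<integral>\<^sup>+x. f x * indicator A (x + y) \<partial>lborel) \<partial>lborel)"
    by (simp add: nn_integral_density)
  also have "\<dots> = (\<integral>\<^sup>+y. \<integral>\<^sup>+x. f (x - y) * g y * indicator A x \<partial>lborel \<partial>lborel)"
    unfolding shift by (simp add: nn_integral_cmult[symmetric] ac_simps)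
  also have "\<dots> = (\<integral>\<^sup>+x. \<integral>\<^sup>+y. f (x - y) * g y * indicator A x \<partial>lborel \<partial>lborel)"
    by (rule lborel_pair.Fubini') measurable
  also have "\<dots> = emeasure ?R A"
    by (simp add: emeasure_density nn_integral_multc)
  finally show "emeasure ?L A = emeasure ?R A" .
qed

text \<open>Substituting m + y for y reduces to the centred convolution, evaluated at x - m.\<close>

lemma conv_normal_density:
  assumes "0 < \<sigma>" "0 < \<rho>"
  shows "(\<integral>\<^sup>+y. ennreal (normal_density 0 \<sigma> (x - y)) * ennreal (normal_density m \<rho> y) \<partial>lborel) =
    ennreal (normal_density m (sqrt (\<sigma>\<^sup>2 + \<rho>\<^sup>2)) x)"
proof -
  have "(\<integral>\<^sup>+y. ennreal (normal_density 0 \<sigma> (x - y)) * ennreal (normal_density m \<rho> y) \<partial>lborel) =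
     (\<integral>\<^sup>+y. ennreal (normal_density 0 \<sigma> (x - m - y) * normal_density 0 \<rho> y) \<partial>lborel)"
    by (subst nn_integral_real_affine[where c = 1 and t = m])
       (auto simp: ennreal_mult'[symmetric] normal_density_def algebra_simps)
  also have "\<dots> = normal_density 0 (sqrt (\<sigma>\<^sup>2 + \<rho>\<^sup>2)) (x - m)"
    using fun_cong[OF conv_normal_density_zero_mean[OF assms]] by simp
  finally show ?thesis by (simp add: normal_density_def)
qed

text \<open>Independence turns the joint law into a product measure, so the sum has the convolution
  as density. Both densities factor over coordinates, hence so does the convolution integral, and
  variances add in each coordinate.\<close>

lemma (in prob_space) distr_add_indep_mvn_isotropic:
  fixes X Y :: "'a \<Rightarrow> real^'n"
  assumes indep: "indep_var borel X borel Y" and pos: "0 < \<sigma>" "0 < \<rho>"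
    and X: "distr M borel X = mvn 0 (\<sigma>\<^sup>2 *\<^sub>R mat 1)"
    and Y: "distr M borel Y = mvn m (\<rho>\<^sup>2 *\<^sub>R mat 1)"
  shows "distr M borel (\<lambda>w. X w + Y w) = mvn m ((\<sigma>\<^sup>2 + \<rho>\<^sup>2) *\<^sub>R mat 1)"
proof -
  let ?f = "mvn_density (0::real^'n) (\<sigma>\<^sup>2 *\<^sub>R mat 1)" and ?g = "mvn_density m (\<rho>\<^sup>2 *\<^sub>R mat 1)"
  let ?r = "sqrt (\<sigma>\<^sup>2 + \<rho>\<^sup>2)"
  \<comment> \<open>The product formula expects a variance written as a square, hence the detour
    through the square root.\<close>
  have r: "0 < ?r" "?r\<^sup>2 = \<sigma>\<^sup>2 + \<rho>\<^sup>2" using pos by (auto simp: add_pos_pos)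
  have [measurable]: "random_variable borel X" "random_variable borel Y"
    using indep by (auto dest: indep_var_rv1 indep_var_rv2)
  have conv: "(\<integral>\<^sup>+y. ennreal (?f (x - y)) * ennreal (?g y) \<partial>lborel) =
      ennreal (mvn_density m ((\<sigma>\<^sup>2 + \<rho>\<^sup>2) *\<^sub>R mat 1) x)" for x
  proof -
    have "(\<integral>\<^sup>+y. ennreal (?f (x - y)) * ennreal (?g y) \<partial>lborel) =
        (\<integral>\<^sup>+y. (\<Prod>b\<in>Basis. ennreal (normal_density 0 \<sigma> (x \<bullet> b - y \<bullet> b)) *
           ennreal (normal_density (m \<bullet> b) \<rho> (y \<bullet> b))) \<partial>lborel)"
      using pos by (simp add: mvn_density_isotropic_prod inner_diff_left prod.distrib prod_ennreal)
    also have "\<dots> = (\<Prod>b\<in>Basis. \<integral>\<^sup>+y. ennreal (normal_density 0 \<sigma> (x \<bullet> b - y)) *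
           ennreal (normal_density (m \<bullet> b) \<rho> y) \<partial>lborel)"
      by (rule nn_integral_lborel_prod[where f = "\<lambda>b y. ennreal (normal_density 0 \<sigma> (x \<bullet> b - y)) *
           ennreal (normal_density (m \<bullet> b) \<rho> y)"]) auto
    also have "\<dots> = ennreal (\<Prod>b\<in>Basis. normal_density (m \<bullet> b) ?r (x \<bullet> b))"
      using pos by (simp add: conv_normal_density prod_ennreal)
    finally show ?thesis
      using mvn_density_isotropic_prod[OF r(1), of m x] r(2) by simp
  qed
  have "distr M borel (\<lambda>w. X w + Y w) =
      distr (distr M (borel \<Otimes>\<^sub>M borel) (\<lambda>w. (X w, Y w))) borel (\<lambda>(x, y). x + y)"
    by (simp add: distr_distr comp_def)
  also have "\<dots> = distr (distr M borel X \<Otimes>\<^sub>M distr M borel Y) borel (\<lambda>(x, y). x + y)"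
    using indep unfolding indep_var_distribution_eq by simp
  also have "\<dots> = mvn m ((\<sigma>\<^sup>2 + \<rho>\<^sup>2) *\<^sub>R mat 1)"
    unfolding X Y mvn_def
    using pos prob_space_mvn_isotropic[of \<sigma> 0] prob_space_mvn_isotropic[of \<rho> m]
    by (subst distr_add_pair_density_lborel)
       (auto simp: conv borel_measurable_mvn_density_isotropic mvn_def[symmetric]
         prob_space_def intro!: measurable_compose[OF _ measurable_ennreal])
  finally show ?thesis .
qed

section \<open>Second moments of Gaussians\<close>

text \<open>Since \<open>u \<le> exp u\<close>, the integrand \<open>\<parallel>z\<parallel>\<^sup>2 exp (- \<parallel>z\<parallel>\<^sup>2 / 2)\<close> is dominated by a multiple
  of the density with variance 2, so no Gaussian moment has to be computed.\<close>

lemma nn_integral_norm_square_std_mvn: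
  "(\<integral>\<^sup>+z. ennreal ((norm z)\<^sup>2) \<partial>mvn (0::real^'n) (1\<^sup>2 *\<^sub>R mat 1)) < \<infinity>"
proof -
  let ?f = "mvn_density (0::real^'n) (1\<^sup>2 *\<^sub>R mat 1)"
  let ?g = "mvn_density (0::real^'n) ((sqrt 2)\<^sup>2 *\<^sub>R mat 1)"
  let ?C = "4 * sqrt 2 ^ CARD('n)"
  have [measurable]: "?f \<in> borel_measurable borel" "?g \<in> borel_measurable borel"
    by (rule borel_measurable_mvn_density_isotropic; simp)+
  have le: "?f z * (norm z)\<^sup>2 \<le> ?C * ?g z" for z
  proof -
    have "(norm z)\<^sup>2 \<le> 4 * exp ((norm z)\<^sup>2 / 4)"
      using exp_ge_add_one_self[of "(norm z)\<^sup>2 / 4"] by linarith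
    then have "exp (- (norm z)\<^sup>2 / 2) * (norm z)\<^sup>2 \<le>
        exp (- (norm z)\<^sup>2 / 2) * (4 * exp ((norm z)\<^sup>2 / 4))"
      by (intro mult_left_mono) auto
    also have "\<dots> = 4 * exp (- (norm z)\<^sup>2 / 4)"
      by (simp flip: exp_add)
    finally have "exp (- (norm z)\<^sup>2 / 2) * (norm z)\<^sup>2 / sqrt (2 * pi) ^ CARD('n) \<le>
        4 * exp (- (norm z)\<^sup>2 / 4) / sqrt (2 * pi) ^ CARD('n)"
      by (intro divide_right_mono) auto
    moreover have "sqrt (2 * pi * (sqrt 2)\<^sup>2) ^ CARD('n) = sqrt 2 ^ CARD('n) * sqrt (2 * pi) ^ CARD('n)"
      by (metis power_mult_distrib real_sqrt_mult mult.commute real_sqrt_pow2 zero_le_numeral)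
    ultimately show ?thesis
      by (subst (1 2) mvn_density_isotropic) simp_all
  qed
  have "(\<integral>\<^sup>+z. ennreal ((norm z)\<^sup>2) \<partial>mvn (0::real^'n) (1\<^sup>2 *\<^sub>R mat 1)) =
      (\<integral>\<^sup>+z. ennreal (?f z * (norm z)\<^sup>2) \<partial>lborel)"
    unfolding mvn_def
    by (subst nn_integral_density)
       (auto simp: ennreal_mult' mvn_density_isotropic_nonneg simp del: power_one)
  also have "\<dots> \<le> (\<integral>\<^sup>+z. ennreal ?C * ennreal (?g z) \<partial>lborel)"
    using le by (intro nn_integral_mono) (simp add: ennreal_leI flip: ennreal_mult')
  also have "\<dots> = ennreal ?C * emeasure (mvn 0 ((sqrt 2)\<^sup>2 *\<^sub>R mat 1)) (UNIV :: (real^'n) set)"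
    by (simp add: nn_integral_cmult mvn_def emeasure_density del: real_sqrt_pow2)
  also have "\<dots> = ennreal ?C"
    using prob_space.emeasure_space_1[OF prob_space_mvn_isotropic[of "sqrt 2" "0::real^'n"]] by simp
  finally show ?thesis
    by (auto intro: le_less_trans)
qed


text \<open>A single standard Gaussian serves as common source for all these laws, which is what
  makes them easy to couple. Its covariance is written \<open>1\<^sup>2 *\<^sub>R mat 1\<close> to
  fit the isotropic lemmas.\<close>

lemma mvn_isotropic_eq_distr_std:
  fixes m :: "real^'n"
  assumes "0 < s"
  shows "mvn m (s\<^sup>2 *\<^sub>R mat 1) = distr (mvn 0 (1\<^sup>2 *\<^sub>R mat 1)) borel (\<lambda>z. m + s *\<^sub>R z)"
  using assms by (subst distr_affine_mvn_isotropic) simp_all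

text \<open>By the parallelogram law the two sides differ by the squared norm of a - b.\<close>

lemma norm_add_square_le:
  fixes a b :: "'a::real_inner"
  shows "(norm (a + b))\<^sup>2 \<le> 2 * (norm a)\<^sup>2 + 2 * (norm b)\<^sup>2"
  using zero_le_power2[of "norm (a - b)"]
  by (simp add: power2_norm_eq_inner inner_add inner_diff inner_commute)

text \<open>A constant that depends only on the dimension, carried by the type argument. The
  integral is finite, so \<open>enn2real\<close> loses nothing; its value is never computed.\<close>

definition std_second_moment :: "'n::finite itself \<Rightarrow> real" where
  "std_second_moment _ = enn2real (\<integral>\<^sup>+z. ennreal ((norm z)\<^sup>2) \<partial>mvn (0::real^'n) (1\<^sup>2 *\<^sub>R mat 1))"

text \<open>One estimate with two uses: finite second moments of the laws, and the cost of coupling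
  two of them.\<close>

lemma nn_integral_norm_affine_std_mvn_le:
  fixes a :: "real^'n"
  shows "(\<integral>\<^sup>+z. ennreal ((norm (a + c *\<^sub>R z))\<^sup>2) \<partial>mvn 0 (1\<^sup>2 *\<^sub>R mat 1)) \<le>
    ennreal (2 * (norm a)\<^sup>2 + 2 * c\<^sup>2 * std_second_moment TYPE('n))" (is "?I \<le> _")
proof -
  let ?G = "mvn (0::real^'n) (1\<^sup>2 *\<^sub>R mat 1)"
  interpret prob_space ?G by (rule prob_space_mvn_isotropic) simp
  have "?I \<le> (\<integral>\<^sup>+z. ennreal (2 * (norm a)\<^sup>2) + ennreal (2 * c\<^sup>2) * ennreal ((norm z)\<^sup>2) \<partial>?G)"
  proof (rule nn_integral_mono)
    fix z
    show "ennreal ((norm (a + c *\<^sub>R z))\<^sup>2) \<le> ennreal (2 * (norm a)\<^sup>2) + ennreal (2 * c\<^sup>2) * ennreal ((norm z)\<^sup>2)"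
      using norm_add_square_le[of a "c *\<^sub>R z"]
      by (simp add: ennreal_mult'[symmetric] ennreal_plus[symmetric] power_mult_distrib ennreal_leI
          del: ennreal_plus)
  qed
  also have "\<dots> = ennreal (2 * (norm a)\<^sup>2) + ennreal (2 * c\<^sup>2) * (\<integral>\<^sup>+z. ennreal ((norm z)\<^sup>2) \<partial>?G)"
    using emeasure_space_1 by (simp add: nn_integral_add nn_integral_cmult)
  also have "(\<integral>\<^sup>+z. ennreal ((norm z)\<^sup>2) \<partial>?G) = ennreal (std_second_moment TYPE('n))"
    using nn_integral_norm_square_std_mvn unfolding std_second_moment_def by (intro ennreal_enn2real[symmetric]) simp
  also have "ennreal (2 * (norm a)\<^sup>2) + ennreal (2 * c\<^sup>2) * ennreal (std_second_moment TYPE('n)) =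
      ennreal (2 * (norm a)\<^sup>2 + 2 * c\<^sup>2 * std_second_moment TYPE('n))"
    by (simp add: ennreal_mult'[symmetric] ennreal_plus[symmetric] std_second_moment_def
        del: ennreal_plus)
  finally show ?thesis .
qed

lemma mvn_isotropic_in_P2:
  fixes m :: "real^'n"
  assumes "0 < s"
  shows "mvn m (s\<^sup>2 *\<^sub>R mat 1) \<in> P2"
proof -
  have "(\<integral>\<^sup>+x. ennreal ((norm x)\<^sup>2) \<partial>mvn m (s\<^sup>2 *\<^sub>R mat 1)) < \<infinity>"
    unfolding mvn_isotropic_eq_distr_std[OF assms]
    using nn_integral_norm_affine_std_mvn_le[of m s]
    by (simp add: nn_integral_distr order_le_less_trans)
  then have "integrable (mvn m (s\<^sup>2 *\<^sub>R mat 1)) (\<lambda>x. (norm x)\<^sup>2)"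
    by (intro integrableI_bounded) auto
  then show ?thesis
    by (simp add: P2_def prob_space_mvn_isotropic assms)
qed

section \<open>Wasserstein bounds from couplings\<close>

text \<open>The joint law of \<open>f\<close> and \<open>g\<close> under the common source is one
  admissible coupling, so its cost bounds the infimum.\<close>

lemma wasserstein2_distr_le:
  fixes f g :: "'w \<Rightarrow> 'a::euclidean_space"
  assumes [measurable]: "f \<in> borel_measurable G" "g \<in> borel_measurable G"
    and le: "(\<integral>\<^sup>+z. ennreal ((dist (f z) (g z))\<^sup>2) \<partial>G) \<le> ennreal B" and B: "0 \<le> B"
  shows "wasserstein2 (distr G borel f) (distr G borel g) \<le> sqrt B"
proof -
  let ?\<gamma> = "distr G (borel \<Otimes>\<^sub>M borel) (\<lambda>z. (f z, g z))"
  have c: "?\<gamma> \<in> couplings (distr G borel f) (distr G borel g)"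
  proof -
    \<comment> \<open>\<open>couplings\<close> takes the marginals as target spaces;
      \<open>distr\<close> sees only their sigma-algebra, which is the Borel one.\<close>
    have "distr ?\<gamma> (distr G borel f) fst = distr ?\<gamma> borel fst"
      by (rule distr_cong) auto
    moreover have "distr ?\<gamma> (distr G borel g) snd = distr ?\<gamma> borel snd"
      by (rule distr_cong) auto
    moreover have "sets ?\<gamma> = sets (distr G borel f \<Otimes>\<^sub>M distr G borel g)"
      unfolding sets_distr by (rule sets_pair_measure_cong) simp_all
    ultimately show ?thesis
      by (simp add: couplings_def distr_distr comp_def)
  qed
  have "(INF \<gamma>\<in>couplings (distr G borel f) (distr G borel g).
       \<integral>\<^sup>+p. ennreal ((dist (fst p) (snd p))\<^sup>2) \<partial>\<gamma>) \<le> ennreal B"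
    by (rule INF_lower2[OF c]) (use le in \<open>simp add: nn_integral_distr\<close>)
  \<comment> \<open>Monotonicity of \<open>enn2real\<close> requires a finite upper bound, which
    \<open>ennreal B\<close> is.\<close>
  from enn2real_mono[OF this] show ?thesis
    using B by (simp add: wasserstein2_def)
qed

lemma wasserstein2_nonneg: "0 \<le> wasserstein2 \<mu> \<nu>"
  by (simp add: wasserstein2_def)

lemma wasserstein2_mvn_isotropic_le:
  fixes a b :: "real^'n"
  assumes "0 < r" "0 < s"
  shows "wasserstein2 (mvn a (r\<^sup>2 *\<^sub>R mat 1)) (mvn b (s\<^sup>2 *\<^sub>R mat 1)) \<le>
    sqrt (2 * (norm (a - b))\<^sup>2 + 2 * (r - s)\<^sup>2 * std_second_moment TYPE('n))"
  unfolding mvn_isotropic_eq_distr_std[OF assms(1)] mvn_isotropic_eq_distr_std[OF assms(2)]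
proof (rule wasserstein2_distr_le)
  have "dist (a + r *\<^sub>R z) (b + s *\<^sub>R z) = norm ((a - b) + (r - s) *\<^sub>R z)" for z
    by (simp add: dist_norm algebra_simps)
  then show "(\<integral>\<^sup>+z. ennreal ((dist (a + r *\<^sub>R z) (b + s *\<^sub>R z))\<^sup>2) \<partial>mvn 0 (1\<^sup>2 *\<^sub>R mat 1)) \<le>
      ennreal (2 * (norm (a - b))\<^sup>2 + 2 * (r - s)\<^sup>2 * std_second_moment TYPE('n))"
    using nn_integral_norm_affine_std_mvn_le[of "a - b" "r - s"] by simp
qed (auto simp: std_second_moment_def)

text \<open>The distance is squeezed between 0 and the coupling bound, which vanishes as mean and
  standard deviation converge.\<close>

lemma wasserstein2_continuous_on_mvn_isotropic:
  fixes m :: "'p::topological_space \<Rightarrow> real^'n"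
  assumes m: "continuous_on D m" and s: "continuous_on D s" and pos: "\<And>p. p \<in> D \<Longrightarrow> 0 < s p"
  shows "wasserstein2_continuous_on D (\<lambda>p. mvn (m p) ((s p)\<^sup>2 *\<^sub>R mat 1))"
  unfolding wasserstein2_continuous_on_def
proof (intro conjI ballI)
  fix p assume p: "p \<in> D"
  show "mvn (m p) ((s p)\<^sup>2 *\<^sub>R mat 1) \<in> P2"
    using pos[OF p] by (rule mvn_isotropic_in_P2)
  let ?B = "\<lambda>q. sqrt (2 * (norm (m q - m p))\<^sup>2 + 2 * (s q - s p)\<^sup>2 * std_second_moment TYPE('n))"
  have lim: "(m \<longlongrightarrow> m p) (at p within D)" "(s \<longlongrightarrow> s p) (at p within D)"
    using m s p by (auto simp: continuous_on_def)
  have "(?B \<longlongrightarrow> sqrt (2 * (norm (m p - m p))\<^sup>2 + 2 * (s p - s p)\<^sup>2 * std_second_moment TYPE('n)))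
      (at p within D)"
    by (intro tendsto_intros lim)
  then have B: "(?B \<longlongrightarrow> 0) (at p within D)" by simp
  \<comment> \<open>Positivity of \<open>s q\<close>, needed for the bound, is known only on
    \<open>D\<close>.\<close>
  have "\<forall>\<^sub>F q in at p within D. q \<in> D"
    by (simp add: eventually_at_filter)
  then have "\<forall>\<^sub>F q in at p within D.
      wasserstein2 (mvn (m q) ((s q)\<^sup>2 *\<^sub>R mat 1)) (mvn (m p) ((s p)\<^sup>2 *\<^sub>R mat 1)) \<le> ?B q"
    by eventually_elim (intro wasserstein2_mvn_isotropic_le pos p)
  then show "((\<lambda>q. wasserstein2 (mvn (m q) ((s q)\<^sup>2 *\<^sub>R mat 1)) (mvn (m p) ((s p)\<^sup>2 *\<^sub>R mat 1)))
      \<longlongrightarrow> 0) (at p within D)"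
    by (intro tendsto_sandwich[OF _ _ tendsto_const B]) (simp_all add: wasserstein2_nonneg)
qed

text \<open>The filter \<open>at p within D\<close> sees only points of \<open>D\<close>, so values
  elsewhere are irrelevant.\<close>

lemma wasserstein2_continuous_on_cong:
  assumes "\<And>p. p \<in> D \<Longrightarrow> L p = L' p"
  shows "wasserstein2_continuous_on D L \<longleftrightarrow> wasserstein2_continuous_on D L'"
proof -
  have "((\<lambda>q. wasserstein2 (L q) (L p)) \<longlongrightarrow> 0) (at p within D) \<longleftrightarrow>
      ((\<lambda>q. wasserstein2 (L' q) (L' p)) \<longlongrightarrow> 0) (at p within D)" if "p \<in> D" for p
    using assms that by (intro filterlim_cong) (auto simp: eventually_at_filter)
  then show ?thesis
    using assms by (simp add: wasserstein2_continuous_on_def)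
qed

section \<open>The time \<open>tau\<close> and the law of \<open>x_tau\<close>\<close>

text \<open>Dividing the nonnegative \<open>tm\<close> by \<Delta> increases it weakly when \<Delta>
  < 1 and decreases it weakly when \<Delta> \<ge> 1, so the minimum follows the case split of
  \<open>x_tau\<close>.\<close>

lemma tau_eq_if:
  assumes "0 \<le> tm" "0 < Delta \<sigma>min tm \<sigma>m"
  shows "tau \<sigma>min tm \<sigma>m = (if Delta \<sigma>min tm \<sigma>m < 1 then tm else tm / Delta \<sigma>min tm \<sigma>m)"
  using assms mult_left_mono[of "Delta \<sigma>min tm \<sigma>m" 1 tm] mult_left_mono[of 1 "Delta \<sigma>min tm \<sigma>m" tm]
  by (auto simp: tau_def min_def field_simps)

lemma Delta_pos:
  assumes "\<sigma>min < 1" "0 \<le> tm" "0 < \<sigma>m"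
  shows "0 < Delta \<sigma>min tm \<sigma>m"
  using assms by (simp add: Delta_def add_nonneg_pos)

text \<open>The second case is the identity \<Delta> - (1 - \<open>\<sigma>min\<close>)
  \<open>tm\<close> = \<open>\<sigma>m\<close>, divided by \<Delta>.\<close>

lemma condot_std_eq:
  assumes "\<sigma>min < 1" "0 \<le> tm" "0 < \<sigma>m"
  shows "1 - (1 - \<sigma>min) * tau \<sigma>min tm \<sigma>m =
    (if Delta \<sigma>min tm \<sigma>m < 1 then 1 - (1 - \<sigma>min) * tm else \<sigma>m / Delta \<sigma>min tm \<sigma>m)"
  unfolding tau_eq_if[OF assms(2) Delta_pos[OF assms]]
  using Delta_pos[OF assms] by (auto simp: field_simps) (simp add: Delta_def algebra_simps)

text \<open>This keeps the target covariance positive definite, where the density formula is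
  valid.\<close>

lemma condot_std_pos:
  assumes "\<sigma>min < 1" "0 \<le> tm" "0 < \<sigma>m"
  shows "0 < 1 - (1 - \<sigma>min) * tau \<sigma>min tm \<sigma>m"
  unfolding condot_std_eq[OF assms] using Delta_pos[OF assms] assms by (auto simp: Delta_def)

lemma on_condot_path_x_tau:
  fixes x1 :: "real^'n"
  assumes ass: "\<sigma>min < 1" "0 \<le> tm" "0 < \<sigma>m" and src: "source_pair M X0 Xm x1 tm \<sigma>m"
  shows "on_condot_path M (x_tau \<sigma>min tm \<sigma>m X0 Xm) \<sigma>min x1 (tau \<sigma>min tm \<sigma>m)"
proof -
  interpret prob_space M using src by (simp add: source_pair_def)
  have indep: "indep_var borel X0 borel Xm"
    and X0: "distr M borel X0 = mvn 0 (1\<^sup>2 *\<^sub>R mat 1)"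
    and Xm: "distr M borel Xm = mvn (tm *\<^sub>R x1) (\<sigma>m\<^sup>2 *\<^sub>R mat 1)"
    using src by (simp_all add: source_pair_def)
  have [measurable]: "random_variable borel X0" "random_variable borel Xm"
    using indep by (auto dest: indep_var_rv1 indep_var_rv2)
  have meas: "x_tau \<sigma>min tm \<sigma>m X0 Xm \<in> borel_measurable M"
    unfolding x_tau_def[abs_def] by measurable
  note std = condot_std_eq[OF ass] and tau = tau_eq_if[OF ass(2) Delta_pos[OF ass]]
  show ?thesis
  proof (cases "Delta \<sigma>min tm \<sigma>m < 1")
    case True
    let ?s = "1 - (1 - \<sigma>min) * tm" and ?c = "sqrt ((1 - (1 - \<sigma>min) * tm)\<^sup>2 - \<sigma>m\<^sup>2)"
    \<comment> \<open>This is \<Delta> < 1 rearranged. The radicand is therefore strictly positive,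
      and the scaled \<open>X0\<close> is again a nondegenerate Gaussian.\<close>
    have "\<sigma>m < ?s" using True by (simp add: Delta_def)
    then have "\<sigma>m\<^sup>2 < ?s\<^sup>2" using ass by (intro power_strict_mono) auto
    then have c: "0 < ?c" "?c\<^sup>2 = ?s\<^sup>2 - \<sigma>m\<^sup>2" by simp_all
    have "distr M borel (\<lambda>w. ?c *\<^sub>R X0 w) = distr (distr M borel X0) borel (\<lambda>x. 0 + ?c *\<^sub>R x)"
      by (simp add: distr_distr comp_def)
    also have "\<dots> = mvn 0 (?c\<^sup>2 *\<^sub>R mat 1)"
      unfolding X0 by (subst distr_affine_mvn_isotropic) (use c(1) in simp_all)
    finally have cX0: "distr M borel (\<lambda>w. ?c *\<^sub>R X0 w) = mvn 0 (?c\<^sup>2 *\<^sub>R mat 1)" .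
    have "indep_var borel ((\<lambda>x. ?c *\<^sub>R x) \<circ> X0) borel ((\<lambda>x. x) \<circ> Xm)"
      by (rule indep_var_compose[OF indep]) auto
    then have "indep_var borel (\<lambda>w. ?c *\<^sub>R X0 w) borel Xm" by (simp add: comp_def)
    from distr_add_indep_mvn_isotropic[OF this c(1) ass(3) cX0 Xm]
    have "distr M borel (\<lambda>w. ?c *\<^sub>R X0 w + Xm w) = mvn (tm *\<^sub>R x1) (?s\<^sup>2 *\<^sub>R mat 1)"
      by (simp add: c(2))
    then show ?thesis
      using True meas std tau by (simp add: on_condot_path_def condot_law_def x_tau_def[abs_def])
  next
    case False
    let ?D = "Delta \<sigma>min tm \<sigma>m"
    have "distr M borel (\<lambda>w. (1 / ?D) *\<^sub>R Xm w) = distr (distr M borel Xm) borel (\<lambda>x. 0 + (1 / ?D) *\<^sub>R x)"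
      by (simp add: distr_distr comp_def)
    also have "\<dots> = mvn ((tm / ?D) *\<^sub>R x1) ((\<sigma>m / ?D)\<^sup>2 *\<^sub>R mat 1)"
      unfolding Xm by (subst distr_affine_mvn_isotropic) (use ass Delta_pos[OF ass] in simp_all)
    finally show ?thesis
      using False meas std tau by (simp add: on_condot_path_def condot_law_def x_tau_def[abs_def])
  qed
qed

text \<open>Written as a minimum, \<open>tau\<close> needs no gluing across \<Delta> = 1; the
  quotient is continuous because \<Delta> is positive on the domain.\<close>

lemma continuous_on_tau:
  assumes "\<sigma>min < 1"
  shows "continuous_on ({0..} \<times> {0<..}) (\<lambda>p. tau \<sigma>min (fst p) (snd p))"
proof -
  have "Delta \<sigma>min (fst p) (snd p) \<noteq> 0" if "p \<in> {0..} \<times> {0<..}" for p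
    using that Delta_pos[OF assms, of "fst p" "snd p"] by auto
  then show ?thesis
    unfolding tau_def Delta_def by (intro continuous_intros) auto
qed

text \<open>In the second conjunct the probability space and both vectors may change with the
  parameters: continuity concerns the laws alone, and no joint distribution across parameters is
  assumed.\<close>

theorem theorem1:
  fixes \<sigma>min :: real and x1 :: "real^'n"
  assumes "0 < \<sigma>min" and "\<sigma>min < 1"
  shows
    "(\<forall>(M :: 'w measure) X0 Xm tm \<sigma>m.
        0 \<le> tm \<longrightarrow> 0 < \<sigma>m \<longrightarrow> source_pair M X0 Xm x1 tm \<sigma>m \<longrightarrow>
        on_condot_path M (x_tau \<sigma>min tm \<sigma>m X0 Xm) \<sigma>min x1 (tau \<sigma>min tm \<sigma>m)) \<and>
     (\<forall>(M :: real \<times> real \<Rightarrow> 'w measure) X0 Xm.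
        (\<forall>tm\<in>{0..}. \<forall>\<sigma>m\<in>{0<..}.
           source_pair (M (tm, \<sigma>m)) (X0 (tm, \<sigma>m)) (Xm (tm, \<sigma>m)) x1 tm \<sigma>m) \<longrightarrow>
        wasserstein2_continuous_on ({0..} \<times> {0<..})
          (\<lambda>(tm, \<sigma>m). distr (M (tm, \<sigma>m)) borel
             (x_tau \<sigma>min tm \<sigma>m (X0 (tm, \<sigma>m)) (Xm (tm, \<sigma>m)))))"
proof (intro conjI allI impI)
  fix M :: "'w measure" and X0 Xm tm \<sigma>m
  assume "0 \<le> tm" "0 < \<sigma>m" "source_pair M X0 Xm x1 tm \<sigma>m"
  then show "on_condot_path M (x_tau \<sigma>min tm \<sigma>m X0 Xm) \<sigma>min x1 (tau \<sigma>min tm \<sigma>m)"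
    by (rule on_condot_path_x_tau[OF assms(2)])
next
  fix M :: "real \<times> real \<Rightarrow> 'w measure" and X0 Xm
  assume src: "\<forall>tm\<in>{0..}. \<forall>\<sigma>m\<in>{0<..}.
    source_pair (M (tm, \<sigma>m)) (X0 (tm, \<sigma>m)) (Xm (tm, \<sigma>m)) x1 tm \<sigma>m"
  let ?D = "{0::real..} \<times> {0::real<..}"
  let ?t = "\<lambda>p. tau \<sigma>min (fst p) (snd p)"
  \<comment> \<open>Continuity is shown for the explicit Gaussian family and then transferred, since
    the first conjunct identifies the two families on \<open>?D\<close>.\<close>
  have "wasserstein2_continuous_on ?D
      (\<lambda>p. mvn (?t p *\<^sub>R x1) ((1 - (1 - \<sigma>min) * ?t p)\<^sup>2 *\<^sub>R mat 1))"
  proof (rule wasserstein2_continuous_on_mvn_isotropic)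
    show "continuous_on ?D (\<lambda>p. ?t p *\<^sub>R x1)"
      by (intro continuous_on_scaleR continuous_on_const continuous_on_tau assms(2))
    show "continuous_on ?D (\<lambda>p. 1 - (1 - \<sigma>min) * ?t p)"
      by (intro continuous_on_diff continuous_on_mult continuous_on_const continuous_on_tau assms(2))
  qed (use condot_std_pos[OF assms(2)] in auto)
  moreover have eq: "(case p of (tm, \<sigma>m) \<Rightarrow> distr (M (tm, \<sigma>m)) borel
      (x_tau \<sigma>min tm \<sigma>m (X0 (tm, \<sigma>m)) (Xm (tm, \<sigma>m)))) =
      mvn (?t p *\<^sub>R x1) ((1 - (1 - \<sigma>min) * ?t p)\<^sup>2 *\<^sub>R mat 1)" if D: "p \<in> ?D" for p
  proof -
    obtain tm \<sigma>m where p: "p = (tm, \<sigma>m)" "0 \<le> tm" "0 < \<sigma>m" using D by auto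
    then have "source_pair (M p) (X0 p) (Xm p) x1 tm \<sigma>m" using src by simp
    from on_condot_path_x_tau[OF assms(2) p(2,3) this] show ?thesis
      by (simp add: p(1) on_condot_path_def condot_law_def)
  qed
  ultimately show "wasserstein2_continuous_on ?D (\<lambda>(tm, \<sigma>m). distr (M (tm, \<sigma>m)) borel
      (x_tau \<sigma>min tm \<sigma>m (X0 (tm, \<sigma>m)) (Xm (tm, \<sigma>m))))"
    by (subst wasserstein2_continuous_on_cong[OF eq])
qed

end
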